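(* Let $\mathcal{H}$ be a real Hilbert space, let $m\geq2$ be an integer, let $I=\{1,\ldots,m\}$, and, for every $i\in I$, let $T_i$ be the projection operator onto a nonempty closed convex subset $C_i$ of $\mathcal{H}$. Set $T=\frac1m\sum_{i\in I}T_i$ and, for every $\varepsilon\in\,]0,1[$, $$R^{\varepsilon}=\big(\operatorname{Id}+\varepsilon(T_m-\operatorname{Id})\big)\circ\cdots\circ\big(\operatorname{Id}+\varepsilon(T_1-\operatorname{Id})\big).$$ Suppose that there exist $\eta\in\,]0,1]$ and $\beta\in\,]0,+\infty[$ such that for every $\varepsilon\in\,]0,\eta[$ there exists $z^{\varepsilon}\in\operatorname{Fix}R^{\varepsilon}$ with $\|z^{\varepsilon}\|\leq\beta$. In addition, suppose that the set $S$ of minimizers over $\mathcal{H}$ of the function $$\Phi\colon\mathcal{H}\to\mathbb{R}\colon x\mapsto\frac{1}{2m}\sum_{i\in I}d_{C_i}^2(x)$$ is a closed affine subspace, say $S=z+E$, where $z\in\mathcal{H}$ and $E$ is a closed vector subspace of $\mathcal{H}$. Let $y_0\in\mathcal{H}$ and set $\overline{x}=P_Sy_0$. For every $\varepsilon\in\,]0,\eta[$, let $(y_n^{\varepsilon})_{n\in\mathbb{N}}$ be defined by $y_0^{\varepsilon}=y_0$ and $$(\forall k\in\mathbb{N})(\forall i\in I)\quad y_{km+i}^{\varepsilon}=\big(\operatorname{Id}+\varepsilon(T_i-\operatorname{Id})\big)y_{km+i-1}^{\varepsilon},$$ and, for every $i\in I$, let $x_i^{\varepsilon}$ be the weak limit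 of $(y_{km+i}^{\varepsilon})_{k\in\mathbb{N}}$ as $k\to+\infty$. Then the following hold. (i) For every $i\in I$, $x_i^{\varepsilon}\rightharpoonup\overline{x}$ as $\varepsilon\to0$. (ii) Suppose that for every $y\in S$ there exist $\rho\in[0,1[$ and $\delta\in\,]0,+\infty[$ such that $$(\forall x\in B(0;\delta)\cap E^{\perp})\quad\|T(x+y)-Ty\|\leq\rho\|x\|.$$ Then, for every $i\in I$, $x_i^{\varepsilon}\to\overline{x}$ as $\varepsilon\to0$.
   Context: $\operatorname{Id}$ is the identity operator and $\operatorname{Fix}$ denotes the set of fixed points. For a nonempty closed convex set $C$, $d_C$ and $P_C$ denote the distance function to $C$ and the projection operator onto $C$. $B(x;\rho)$ is the closed ball with center $x$ and radius $\rho$. The symbols $\rightharpoonup$ and $\to$ denote weak and strong convergence, respectively. Known fact making the objects well defined: for every $\varepsilon\in\,]0,\eta[$, since $\operatorname{Fix}R^{\varepsilon}\neq\varnothing$, the weak limits $x_i^{\varepsilon}$ exist and satisfy the cycle equations $x_1^{\varepsilon}=(\operatorname{Id}+\varepsilon(T_1-\operatorname{Id}))x_m^{\varepsilon}$ and $x_i^{\varepsilon}=(\operatorname{Id}+\varepsilon(T_i-\operatorname{Id}))x_{i-1}^{\varepsilon}$ for $2\leq i\leq m$. *)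

theory Defs
  imports "HOL-Analysis.Analysis"
begin

(* The library's closest_point is restricted to the class heine_borel, hence to
   finite dimension.  As there, metric_proj C is meaningful only where a nearest
   point exists, e.g. for nonempty closed convex C in a Hilbert space. *)
definition metric_proj :: "'a::real_inner set \<Rightarrow> 'a \<Rightarrow> 'a" where
  "metric_proj C x = (THE p. p \<in> C \<and> dist x p = infdist x C)"

definition Fix :: "('a \<Rightarrow> 'a) \<Rightarrow> 'a set" where
  "Fix f = {x. f x = x}"

(* Id + e (T - Id) *)
definition relax :: "real \<Rightarrow> ('a::real_vector \<Rightarrow> 'a) \<Rightarrow> 'a \<Rightarrow> 'a" where
  "relax e T x = x + e *\<^sub>R (T x - x)"

(* cyclic_comp T e m = relax e (T m) o ... o relax e (T 1); T 0 is never used. *)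
primrec cyclic_comp ::
  "(nat \<Rightarrow> 'a::real_vector \<Rightarrow> 'a) \<Rightarrow> real \<Rightarrow> nat \<Rightarrow> 'a \<Rightarrow> 'a" where
  "cyclic_comp T e 0 = id"
| "cyclic_comp T e (Suc n) = relax e (T (Suc n)) \<circ> cyclic_comp T e n"

(* Weak convergence in a Hilbert space, along an arbitrary filter. *)
definition weakly_tendsto :: "('b \<Rightarrow> 'a::real_inner) \<Rightarrow> 'a \<Rightarrow> 'b filter \<Rightarrow> bool" where
  "weakly_tendsto f l F \<longleftrightarrow> (\<forall>u. ((\<lambda>t. f t \<bullet> u) \<longlongrightarrow> l \<bullet> u) F)"

definition weak_Lim :: "'b filter \<Rightarrow> ('b \<Rightarrow> 'a::real_inner) \<Rightarrow> 'a" where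
  "weak_Lim F f = (THE l. weakly_tendsto f l F)"

lemma weakly_tendsto_unique:
  assumes "F \<noteq> bot" "weakly_tendsto f a F" "weakly_tendsto f b F"
  shows "a = b"
proof -
  have "a \<bullet> u = b \<bullet> u" for u
    using assms tendsto_unique unfolding weakly_tendsto_def by blast
  then show ?thesis by (metis vector_eq_ldot inner_commute)
qed

lemma weak_Lim_eq:
  assumes "F \<noteq> bot" "weakly_tendsto f l F"
  shows "weak_Lim F f = l"
  unfolding weak_Lim_def using assms weakly_tendsto_unique by (intro the_equality) auto

end

theory Submission
  imports Defs
begin

text \<open>
  Write \<open>T\<close> for the mean of the projections \<open>T\<^sub>i\<close>, and \<open>R\<^sub>\<epsilon>\<close> for the composition of the
  relaxed projections \<open>Id + \<epsilon>(T\<^sub>i - Id)\<close>.  Along the iteration the points with index \<open>k m\<close> are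
  the iterates of \<open>R\<^sub>\<epsilon>\<close>, and those with index \<open>k m + i\<close> are their images under the first \<open>i\<close>
  factors.  Each factor is firmly nonexpansive, so \<open>R\<^sub>\<epsilon>\<close> is
  averaged; its iterates are asymptotically regular and, by Opial's argument, converge weakly to a
  fixed point \<open>p\<^sub>\<epsilon>\<close>.  The same regularity shows that the differences between consecutive
  points approach those of the cycle through \<open>p\<^sub>\<epsilon>\<close>, which makes the weak limit with
  index \<open>i\<close> the image of \<open>p\<^sub>\<epsilon>\<close> under the first \<open>i\<close> factors
  (\<open>cyclic_iteration_weak_limits\<close>).  Two facts then single out the limit as \<open>\<epsilon>\<close> tends to \<open>0\<close>.

  \<^item> Uniformly on bounded sets, \<open>R\<^sub>\<epsilon> = Id + \<epsilon> m (T - Id) + O(\<epsilon>\<^sup>2)\<close> (\<open>cyclic_comp_first_order\<close>).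
    The fixed points \<open>p\<^sub>\<epsilon>\<close> stay bounded, hence \<open>T p\<^sub>\<epsilon> - p\<^sub>\<epsilon> = O(\<epsilon>)\<close>, and demiclosedness makes
    every weak cluster point of \<open>p\<^sub>\<epsilon>\<close> a fixed point of \<open>T\<close>, that is, an element of \<open>S\<close>
    (\<open>sum_infdist_sq_minimal_iff\<close>).
  \<^item> All displacements \<open>T\<^sub>i v - v\<close> are orthogonal to \<open>E\<close>
    (\<open>residual_orthogonal_to_minimal_line\<close>): the residual of each projection is constant on \<open>S\<close>,
    so \<open>C\<^sub>i\<close> contains a translate of every line in \<open>E\<close>.  The iteration therefore never moves along
    \<open>E\<close>, and \<open>p\<^sub>\<epsilon> - y\<^sub>0\<close> is orthogonal to \<open>E\<close>.

  The only point of \<open>S\<close> whose difference from \<open>y\<^sub>0\<close> is orthogonal to \<open>E\<close> is the projection of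
  \<open>y\<^sub>0\<close> onto \<open>S\<close>, so it is the only weak cluster point, and a bounded family with one weak cluster
  point converges weakly to it.  For strong convergence, \<open>p\<^sub>\<epsilon>\<close> minus the limit lies in the
  orthogonal complement of \<open>E\<close>, where the local contraction bounds the distance to the limit by the
  residual \<open>T p\<^sub>\<epsilon> - p\<^sub>\<epsilon>\<close> (\<open>residual_lower_bound_of_local_contraction\<close>).  Passing from \<open>p\<^sub>\<epsilon>\<close> to
  the other points of the cycle costs only \<open>O(\<epsilon>)\<close>.
\<close>

section \<open>Projections onto closed convex sets\<close>

text \<open>
  Near-minimizers of the distance in \<open>C\<close> form a decreasing sequence of closed sets.  By the
  parallelogram law and convexity (the midpoint of two near-minimizers is no closer to \<open>a\<close> than
  the infimum) their diameters tend to zero, so completeness yields a common point.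
\<close>

lemma nearest_point_exists:
  fixes C :: "'a::{real_inner, complete_space} set"
  assumes "C \<noteq> {}" "closed C" "convex C"
  shows "\<exists>p\<in>C. dist a p = infdist a C"
proof -
  define d where "d = infdist a C"
  have d0: "d \<ge> 0" by (simp add: d_def infdist_nonneg)
  define N where "N n = C \<inter> cball a (d + 1 / Suc n)" for n
  have nonempty: "N n \<noteq> {}" for n
  proof -
    have "(INF c\<in>C. dist a c) < d + 1 / Suc n"
      using assms(1) by (simp add: d_def infdist_notempty)
    then obtain c where "c \<in> C" "dist a c < d + 1 / Suc n"
      using assms(1) by (auto simp: cINF_less_iff)
    then show ?thesis by (auto simp: N_def intro!: less_imp_le)
  qed
  have anti: "N n \<subseteq> N k" if "k \<le> n" for k n
  proof -
    have "1 / real (Suc n) \<le> 1 / real (Suc k)"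
      using that by (simp add: frac_le)
    then show ?thesis by (auto simp: N_def)
  qed
  have diam: "(dist u v)\<^sup>2 \<le> 4 * (2 * d + 1) * (1 / Suc n)" if "u \<in> N n" "v \<in> N n" for u v n
  proof -
    define t where "t = 1 / real (Suc n)"
    have t: "0 < t" "t \<le> 1" by (simp_all add: t_def)
    have "(1/2) *\<^sub>R u + (1/2) *\<^sub>R v \<in> C"
      using that convexD[OF assms(3), of u v "1/2" "1/2"] by (simp add: N_def)
    then have "d \<le> norm (a - ((1/2) *\<^sub>R u + (1/2) *\<^sub>R v))" (is "_ \<le> ?mid")
      using infdist_le[of _ C a] by (simp add: d_def dist_norm)
    then have "d\<^sup>2 \<le> ?mid\<^sup>2"
      using d0 by (intro power_mono) auto
    moreover have "(norm (a - u))\<^sup>2 \<le> (d + t)\<^sup>2" "(norm (a - v))\<^sup>2 \<le> (d + t)\<^sup>2"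
      using that by (auto simp: N_def dist_norm t_def intro!: power_mono)
    moreover have "(norm (u - v))\<^sup>2 = 2 * (norm (a - u))\<^sup>2 + 2 * (norm (a - v))\<^sup>2
        - 4 * ?mid\<^sup>2"
      by (simp add: power2_norm_eq_inner inner_add inner_diff inner_commute algebra_simps)
    ultimately have "(norm (u - v))\<^sup>2 \<le> 4 * ((d + t)\<^sup>2 - d\<^sup>2)" by argo
    also have "(d + t)\<^sup>2 - d\<^sup>2 = (2 * d + t) * t"
      by (simp add: power2_eq_square algebra_simps)
    also have "4 * ((2 * d + t) * t) \<le> 4 * (2 * d + 1) * t"
      using t d0 by (simp add: mult_right_mono)
    finally show ?thesis by (simp add: dist_norm t_def)
  qed
  have small: "\<exists>n. \<forall>u\<in>N n. \<forall>v\<in>N n. dist u v < e" if "e > 0" for e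
  proof -
    have "(\<lambda>n. 4 * (2 * d + 1) * (1 / real (Suc n))) \<longlonglongrightarrow> 4 * (2 * d + 1) * 0"
      by (intro tendsto_mult_left) (use LIMSEQ_Suc[OF lim_1_over_n] in simp)
    then have "eventually (\<lambda>n. 4 * (2 * d + 1) * (1 / real (Suc n)) < e\<^sup>2) sequentially"
      using that by (intro order_tendstoD(2)[where a="e\<^sup>2"]) auto
    then obtain n where n: "4 * (2 * d + 1) * (1 / real (Suc n)) < e\<^sup>2"
      by (auto simp: eventually_sequentially)
    then have "dist u v < e" if "u \<in> N n" "v \<in> N n" for u v
      using diam[OF that] \<open>e > 0\<close> by (metis le_less_trans less_imp_le power_less_imp_less_base)
    then show ?thesis by blast
  qed
  have closed: "closed (N n)" for n
    using assms(2) by (simp add: N_def closed_Int)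
  obtain p where p: "p \<in> N n" for n
    using decreasing_closed_nest[of N, OF closed nonempty anti small] by auto
  have "dist a p \<le> d + 1 / Suc n" for n using p[of n] by (simp add: N_def)
  moreover have "(\<lambda>n. d + 1 / real (Suc n)) \<longlonglongrightarrow> d + 0"
    by (intro tendsto_add tendsto_const) (use LIMSEQ_Suc[OF lim_1_over_n] in simp)
  ultimately have "dist a p \<le> d" using LIMSEQ_le_const by fastforce
  moreover have "p \<in> C" using p[of 0] by (simp add: N_def)
  ultimately show ?thesis by (metis antisym d_def infdist_le)
qed

text \<open>
  Otherwise a small step from \<open>p\<close> towards \<open>c\<close>, which stays in \<open>C\<close>, would come closer to \<open>a\<close>.
\<close>

lemma nearest_point_inner_le:
  fixes C :: "'a::real_inner set"
  assumes "convex C" "p \<in> C" "dist a p = infdist a C" "c \<in> C"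
  shows "(a - p) \<bullet> (c - p) \<le> 0"
proof (rule ccontr)
  assume "\<not> ?thesis"
  then obtain u where u: "u > 0" "u \<le> 1" "dist (p + u *\<^sub>R (c - p)) a < dist p a"
    using closer_point_lemma[of a p c] by auto
  have "(1 - u) *\<^sub>R p + u *\<^sub>R c \<in> C"
    using assms u by (simp add: convexD_alt)
  then have "infdist a C \<le> dist a (p + u *\<^sub>R (c - p))"
    using infdist_le by (simp add: algebra_simps)
  then show False using u assms(3) by (simp add: dist_commute)
qed

text \<open>
  Under the variational inequality, replacing \<open>p\<close> by another point \<open>c\<close> of \<open>C\<close> increases the
  squared distance from \<open>a\<close> by at least the squared distance between \<open>c\<close> and \<open>p\<close>; this gives both
  minimality and uniqueness.
\<close>

lemma metric_proj_eqI:
  fixes C :: "'a::real_inner set"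
  assumes "p \<in> C" "\<And>c. c \<in> C \<Longrightarrow> (a - p) \<bullet> (c - p) \<le> 0"
  shows "metric_proj C a = p"
proof -
  have pyth: "(dist a p)\<^sup>2 + (dist c p)\<^sup>2 \<le> (dist a c)\<^sup>2" if "c \<in> C" for c
    using assms(2)[OF that]
    by (simp add: dist_norm power2_norm_eq_inner inner_diff inner_commute)
  have "dist a p \<le> dist a c" if "c \<in> C" for c
  proof (rule power2_le_imp_le)
    show "(dist a p)\<^sup>2 \<le> (dist a c)\<^sup>2"
      using pyth[OF that] zero_le_power2[of "dist c p"] by linarith
  qed simp
  then have "dist a p \<le> infdist a C"
    using assms(1) by (subst infdist_notempty) (auto intro!: cINF_greatest)
  then have *: "dist a p = infdist a C"
    using infdist_le[OF assms(1), of a] by simp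
  have "q = p" if "q \<in> C" "dist a q = infdist a C" for q
    using pyth[OF that(1)] that(2) * by simp
  then show "metric_proj C a = p"
    unfolding metric_proj_def using assms(1) * by blast
qed

lemma metric_proj:
  fixes C :: "'a::{real_inner, complete_space} set"
  assumes "C \<noteq> {}" "closed C" "convex C"
  shows metric_proj_in: "metric_proj C a \<in> C"
    and dist_metric_proj: "dist a (metric_proj C a) = infdist a C"
    and metric_proj_inner_le: "c \<in> C \<Longrightarrow> (a - metric_proj C a) \<bullet> (c - metric_proj C a) \<le> 0"
proof -
  obtain p where p: "p \<in> C" "dist a p = infdist a C"
    using nearest_point_exists[OF assms] by blast
  then have *: "metric_proj C a = p"
    using nearest_point_inner_le[OF assms(3)] by (intro metric_proj_eqI) auto
  show "metric_proj C a \<in> C" "dist a (metric_proj C a) = infdist a C" using * p by auto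
  show "c \<in> C \<Longrightarrow> (a - metric_proj C a) \<bullet> (c - metric_proj C a) \<le> 0"
    using * p nearest_point_inner_le[OF assms(3)] by auto
qed

definition firmly_nonexpansive :: "('a::real_inner \<Rightarrow> 'a) \<Rightarrow> bool" where
  "firmly_nonexpansive f \<longleftrightarrow> (\<forall>u v. (norm (f u - f v))\<^sup>2 \<le> (f u - f v) \<bullet> (u - v))"

definition nonexpansive :: "('a::real_normed_vector \<Rightarrow> 'a) \<Rightarrow> bool" where
  "nonexpansive f \<longleftrightarrow> (\<forall>u v. norm (f u - f v) \<le> norm (u - v))"

lemma firmly_nonexpansive_imp_nonexpansive:
  assumes "firmly_nonexpansive f"
  shows "nonexpansive f"
  unfolding nonexpansive_def
proof (intro allI)
  fix u v
  have "(norm (f u - f v))\<^sup>2 \<le> (f u - f v) \<bullet> (u - v)"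
    using assms by (simp add: firmly_nonexpansive_def)
  also have "\<dots> \<le> norm (f u - f v) * norm (u - v)"
    by (rule norm_cauchy_schwarz)
  finally show "norm (f u - f v) \<le> norm (u - v)"
    by (cases "f u = f v") (simp_all add: power2_eq_square)
qed

text \<open>
  Add the variational inequalities of the two projections, each tested with the other one.
\<close>

lemma firmly_nonexpansive_metric_proj:
  fixes C :: "'a::{real_inner, complete_space} set"
  assumes "C \<noteq> {}" "closed C" "convex C"
  shows "firmly_nonexpansive (metric_proj C)"
  unfolding firmly_nonexpansive_def
proof (intro allI)
  fix u v
  let ?p = "metric_proj C u" and ?q = "metric_proj C v"
  have "(u - ?p) \<bullet> (?q - ?p) \<le> 0" "(v - ?q) \<bullet> (?p - ?q) \<le> 0"
    using assms by (simp_all add: metric_proj_inner_le metric_proj_in)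
  then show "(norm (?p - ?q))\<^sup>2 \<le> (?p - ?q) \<bullet> (u - v)"
    by (simp add: power2_norm_eq_inner inner_diff inner_commute)
qed

section \<open>Weak compactness along filters\<close>

text \<open>
  A vector off the kernel, minus its projection onto the kernel, spans the orthogonal complement of
  the kernel; a suitable multiple of it represents the functional.
\<close>

lemma riesz_representation:
  fixes l :: "'a::{real_inner, complete_space} \<Rightarrow> real"
  assumes "bounded_linear l"
  shows "\<exists>w. \<forall>u. l u = w \<bullet> u"
proof (cases "\<forall>u. l u = 0")
  case True
  then show ?thesis by (intro exI[of _ 0]) simp
next
  case False
  then obtain v where v: "l v \<noteq> 0" by blast
  interpret bounded_linear l by fact
  define K where "K = {u. l u = 0}"
  have "0 \<in> K" by (simp add: K_def zero)
  moreover have "closed K" "convex K"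
    by (auto simp: K_def convex_def add scaleR
        intro!: closed_Collect_eq continuous_intros continuous_on)
  ultimately have K: "K \<noteq> {}" "closed K" "convex K" by blast+
  define p where "p = v - metric_proj K v"
  have lp: "l p = l v"
    using metric_proj_in[OF K, of v] by (simp add: p_def K_def diff)
  have orth: "p \<bullet> u = 0" if "l u = 0" for u
  proof -
    have "metric_proj K v + u \<in> K" "metric_proj K v - u \<in> K"
      using metric_proj_in[OF K, of v] that by (simp_all add: K_def add diff)
    from this[THEN metric_proj_inner_le[OF K, of _ v]] show ?thesis
      by (simp add: p_def)
  qed
  have "p \<noteq> 0" using lp v zero by auto
  have "l u = ((l v / (p \<bullet> p)) *\<^sub>R p) \<bullet> u" for u
  proof -
    have "l (u - (l u / l v) *\<^sub>R p) = 0" using v by (simp add: diff scaleR lp)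
    from orth[OF this] have "p \<bullet> u = (l u / l v) * (p \<bullet> p)" by (simp add: inner_diff)
    then show ?thesis using v \<open>p \<noteq> 0\<close> by simp
  qed
  then show ?thesis by blast
qed

text \<open>
  Weak compactness of bounded sets, phrased with filters so that it serves both sequences and the
  limit as \<open>\<epsilon>\<close> tends to \<open>0\<close>.  The functions \<open>u \<mapsto> f t \<bullet> u\<close> eventually lie in a product of compact
  intervals, which is compact by Tychonoff's theorem.  A cluster point of them is a bounded linear
  functional, and its Riesz representative is a weak limit along a finer filter.
\<close>

lemma bounded_imp_weakly_convergent_refinement:
  fixes f :: "'b \<Rightarrow> 'a::{real_inner, complete_space}"
  assumes F: "F \<noteq> bot" and bound: "eventually (\<lambda>t. norm (f t) \<le> B) F"
  shows "\<exists>F' l. F' \<le> F \<and> F' \<noteq> bot \<and> weakly_tendsto f l F'"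
proof -
  define g where "g = (\<lambda>t (u::'a). f t \<bullet> u)"
  define U where "U = Pi\<^sub>E UNIV (\<lambda>u::'a. {- (B * norm u) .. B * norm u})"
  have "compactin (product_topology (\<lambda>_. euclidean) UNIV) U"
    unfolding U_def by (subst compactin_PiE) auto
  then have compact: "compact U" by (simp add: euclidean_product_topology)
  have in_U: "eventually (\<lambda>h. h \<in> U) (filtermap g F)"
    unfolding eventually_filtermap using bound
  proof eventually_elim
    case (elim t)
    have "\<bar>f t \<bullet> u\<bar> \<le> B * norm u" for u
      using Cauchy_Schwarz_ineq2[of "f t" u] mult_right_mono[OF elim norm_ge_zero[of u]] by linarith
    then have "f t \<bullet> u \<le> B * norm u" "- (B * norm u) \<le> f t \<bullet> u" for u
      by (smt (verit))+
    then show ?case by (auto simp: U_def g_def)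
  qed
  have "filtermap g F \<noteq> bot" using F by (simp add: filtermap_bot_iff)
  then obtain L where L: "inf (nhds L) (filtermap g F) \<noteq> bot"
    using compact_filter[THEN iffD1, OF compact] in_U by blast
  define F' where "F' = inf F (filtercomap g (nhds L))"
  have "F' \<noteq> bot"
  proof
    assume "F' = bot"
    then have "eventually (\<lambda>_. False) F'" by simp
    then obtain P Q where PQ: "eventually P F" "eventually Q (filtercomap g (nhds L))"
        "\<And>t. P t \<Longrightarrow> Q t \<Longrightarrow> False"
      unfolding F'_def eventually_inf by blast
    then obtain Q' where Q': "eventually Q' (nhds L)" "\<And>t. Q' (g t) \<Longrightarrow> Q t"
      unfolding eventually_filtercomap by blast
    have "eventually (\<lambda>h. \<not> Q' h) (filtermap g F)"
      unfolding eventually_filtermap using PQ(1) by eventually_elim (use PQ(3) Q'(2) in blast)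
    with Q'(1) have "eventually (\<lambda>_. False) (inf (nhds L) (filtermap g F))"
      unfolding eventually_inf by blast
    with L show False by (simp add: eventually_False)
  qed
  have lim: "((\<lambda>t. f t \<bullet> u) \<longlongrightarrow> L u) F'" for u
  proof -
    have g: "filterlim g (nhds L) F'"
      unfolding F'_def by (meson filterlim_filtercomap filterlim_mono inf_le2 order_refl)
    show ?thesis
    proof (rule topological_tendstoI)
      fix W :: "real set"
      assume W: "open W" "L u \<in> W"
      have "open ((\<lambda>h. h u) -` W)"
        using continuous_on_product_coordinates W(1) by (rule open_vimage[rotated])
      then have "eventually (\<lambda>h. h u \<in> W) (nhds L)"
        using eventually_nhds_in_open[of "(\<lambda>h. h u) -` W" L] W(2) by simp
      from eventually_compose_filterlim[OF this g]
      show "eventually (\<lambda>t. f t \<bullet> u \<in> W) F'" by (simp add: g_def)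
    qed
  qed
  have "bounded_linear L"
  proof (rule bounded_linear_intro)
    show "L (u + v) = L u + L v" for u v
      using tendsto_unique[OF \<open>F' \<noteq> bot\<close> lim[of "u + v"]] tendsto_add[OF lim[of u] lim[of v]]
      by (simp add: inner_add_right)
    show "L (r *\<^sub>R u) = r *\<^sub>R L u" for r u
      using tendsto_unique[OF \<open>F' \<noteq> bot\<close> lim[of "r *\<^sub>R u"]] tendsto_mult_left[OF lim[of u], of r]
      by simp
    show "norm (L u) \<le> norm u * B" for u
    proof (rule tendsto_upperbound[OF tendsto_norm[OF lim] _ \<open>F' \<noteq> bot\<close>])
      have "eventually (\<lambda>t. norm (f t) \<le> B) F'"
        using bound by (simp add: F'_def filter_leD[OF inf_le1])
      then show "eventually (\<lambda>t. norm (f t \<bullet> u) \<le> norm u * B) F'"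
      proof eventually_elim
        case (elim t)
        then show ?case
          using Cauchy_Schwarz_ineq2[of "f t" u] mult_right_mono[OF elim norm_ge_zero[of u]]
          by (simp add: mult.commute)
      qed
    qed
  qed
  then obtain w where "L u = w \<bullet> u" for u using riesz_representation by metis
  then have "weakly_tendsto f w F'" using lim by (simp add: weakly_tendsto_def)
  moreover have "F' \<le> F" by (simp add: F'_def)
  ultimately show ?thesis using \<open>F' \<noteq> bot\<close> by blast
qed

text \<open>
  If \<open>f\<close> stayed off a weak neighbourhood of \<open>l\<close> frequently along \<open>F\<close>, some refinement of \<open>F\<close>
  would give it a weak limit other than \<open>l\<close>.
\<close>

lemma weakly_tendstoI_refinements:
  fixes f :: "'b \<Rightarrow> 'a::{real_inner, complete_space}"
  assumes bound: "eventually (\<lambda>t. norm (f t) \<le> B) F"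
    and unique: "\<And>F' l'. F' \<le> F \<Longrightarrow> F' \<noteq> bot \<Longrightarrow> weakly_tendsto f l' F' \<Longrightarrow> l' = l"
  shows "weakly_tendsto f l F"
  unfolding weakly_tendsto_def
proof (intro allI topological_tendstoI)
  fix u :: 'a and W :: "real set"
  assume W: "open W" "l \<bullet> u \<in> W"
  show "eventually (\<lambda>t. f t \<bullet> u \<in> W) F"
  proof (rule ccontr)
    assume *: "\<not> ?thesis"
    define G where "G = inf F (principal {t. f t \<bullet> u \<notin> W})"
    have "G \<noteq> bot"
      using * unfolding G_def trivial_limit_def eventually_inf_principal by simp
    moreover have "G \<le> F" by (simp add: G_def)
    ultimately obtain F' l' where F': "F' \<le> G" "F' \<noteq> bot" "weakly_tendsto f l' F'"
      using bounded_imp_weakly_convergent_refinement[OF _ filter_leD[OF _ bound]] by blast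
    have "l' = l" using unique F' \<open>G \<le> F\<close> by (meson order_trans)
    then have "eventually (\<lambda>t. f t \<bullet> u \<in> W) F'"
      using F'(3) W by (auto simp: weakly_tendsto_def dest: topological_tendstoD)
    moreover have "eventually (\<lambda>t. f t \<bullet> u \<notin> W) G"
      unfolding G_def eventually_inf_principal by simp
    then have "eventually (\<lambda>t. f t \<bullet> u \<notin> W) F'" using F'(1) by (rule filter_leD[rotated])
    ultimately have "eventually (\<lambda>_. False) F'" by eventually_elim simp
    then show False using F'(2) by (simp add: eventually_False)
  qed
qed

lemma weakly_tendsto_strong_perturbation:
  assumes "weakly_tendsto f l F" "((\<lambda>t. g t - f t) \<longlongrightarrow> c) F"
  shows "weakly_tendsto g (l + c) F"
  unfolding weakly_tendsto_def
proof
  fix u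
  have "((\<lambda>t. f t \<bullet> u) \<longlongrightarrow> l \<bullet> u) F"
    using assms(1) by (simp add: weakly_tendsto_def)
  from tendsto_add[OF this tendsto_inner[OF assms(2) tendsto_const]]
  have "((\<lambda>t. f t \<bullet> u + (g t - f t) \<bullet> u) \<longlongrightarrow> l \<bullet> u + c \<bullet> u) F" .
  then show "((\<lambda>t. g t \<bullet> u) \<longlongrightarrow> (l + c) \<bullet> u) F"
    by (simp add: inner_add_left inner_diff_left)
qed

text \<open>
  Closed balls are weakly closed: test the weak convergence with \<open>l - c\<close> and use Cauchy-Schwarz.
\<close>

lemma weakly_tendsto_norm_diff_le:
  assumes "weakly_tendsto f l F" "F \<noteq> bot" "eventually (\<lambda>t. norm (f t - c) \<le> B) F"
  shows "norm (l - c) \<le> B"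
proof -
  have lim: "((\<lambda>t. f t \<bullet> (l - c) - c \<bullet> (l - c)) \<longlongrightarrow> l \<bullet> (l - c) - c \<bullet> (l - c)) F"
    using assms(1) by (intro tendsto_diff tendsto_const) (simp add: weakly_tendsto_def)
  have "l \<bullet> (l - c) - c \<bullet> (l - c) \<le> B * norm (l - c)"
  proof (rule tendsto_upperbound[OF lim _ assms(2)])
    show "eventually (\<lambda>t. f t \<bullet> (l - c) - c \<bullet> (l - c) \<le> B * norm (l - c)) F"
      using assms(3)
    proof eventually_elim
      case (elim t)
      have "(f t - c) \<bullet> (l - c) \<le> norm (f t - c) * norm (l - c)"
        by (rule norm_cauchy_schwarz)
      also have "\<dots> \<le> B * norm (l - c)" using elim by (rule mult_right_mono) simp
      finally show ?case by (simp add: inner_diff_left)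
    qed
  qed
  then have *: "norm (l - c) * norm (l - c) \<le> B * norm (l - c)"
    by (simp flip: inner_diff_left power2_norm_eq_inner power2_eq_square)
  have "0 \<le> B"
    using eventually_happens'[OF assms(2,3)] norm_ge_zero by (meson order_trans)
  with * show ?thesis by (cases "l = c") auto
qed

section \<open>Iterates of nonexpansive operators\<close>

text \<open>
  Demiclosedness of \<open>Id - f\<close> at \<open>0\<close>.  Nonexpansiveness makes \<open>x t\<close> asymptotically no farther from
  \<open>f l\<close> than from \<open>l\<close>, whereas weak convergence makes the squared distance to \<open>f l\<close> asymptotically
  larger by the square of \<open>norm (l - f l)\<close>.
\<close>

lemma nonexpansive_demiclosed:
  fixes f :: "'a::real_inner \<Rightarrow> 'a"
  assumes f: "nonexpansive f" and F: "F \<noteq> bot"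
    and weak: "weakly_tendsto x l F" and bound: "eventually (\<lambda>t. norm (x t) \<le> B) F"
    and res: "((\<lambda>t. x t - f (x t)) \<longlongrightarrow> 0) F"
  shows "f l = l"
proof -
  define r where "r t = norm (x t - f (x t))" for t
  have r: "(r \<longlongrightarrow> 0) F"
    unfolding r_def using tendsto_norm_zero[OF res] .
  have "((\<lambda>t. x t \<bullet> (l - f l)) \<longlongrightarrow> l \<bullet> (l - f l)) F"
    using weak by (simp add: weakly_tendsto_def)
  from tendsto_diff[OF this tendsto_const]
  have w: "((\<lambda>t. x t \<bullet> (l - f l) - l \<bullet> (l - f l)) \<longlongrightarrow> l \<bullet> (l - f l) - l \<bullet> (l - f l)) F" .
  have "((\<lambda>t. (r t)\<^sup>2 + 2 * r t * (B + norm l) - 2 * (x t \<bullet> (l - f l) - l \<bullet> (l - f l)))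
      \<longlongrightarrow> 0\<^sup>2 + 2 * 0 * (B + norm l) - 2 * (l \<bullet> (l - f l) - l \<bullet> (l - f l))) F"
    by (intro tendsto_diff tendsto_mult_left[OF w] tendsto_intros r)
  then have lim: "((\<lambda>t. (r t)\<^sup>2 + 2 * r t * (B + norm l) - 2 * (x t \<bullet> (l - f l) - l \<bullet> (l - f l)))
      \<longlongrightarrow> 0) F" by simp
  have "(norm (l - f l))\<^sup>2 \<le> 0"
  proof (rule tendsto_lowerbound[OF lim _ F])
    show "eventually (\<lambda>t. (norm (l - f l))\<^sup>2
        \<le> (r t)\<^sup>2 + 2 * r t * (B + norm l) - 2 * (x t \<bullet> (l - f l) - l \<bullet> (l - f l))) F"
      using bound
    proof eventually_elim
      case (elim t)
      have "norm (x t - f l) \<le> norm (x t - f (x t)) + norm (f (x t) - f l)"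
        using norm_triangle_ineq[of "x t - f (x t)" "f (x t) - f l"] by simp
      also have "\<dots> \<le> r t + norm (x t - l)"
        using f by (simp add: r_def nonexpansive_def)
      finally have "(norm (x t - f l))\<^sup>2 \<le> (r t + norm (x t - l))\<^sup>2"
        by (rule power_mono) simp
      also have "\<dots> = (r t)\<^sup>2 + 2 * r t * norm (x t - l) + (norm (x t - l))\<^sup>2"
        by (simp add: power2_eq_square algebra_simps)
      also have "2 * r t * norm (x t - l) \<le> 2 * r t * (B + norm l)"
        using elim norm_triangle_ineq4[of "x t" l] by (intro mult_left_mono) (auto simp: r_def)
      finally have "(norm (x t - f l))\<^sup>2
          \<le> (r t)\<^sup>2 + 2 * r t * (B + norm l) + (norm (x t - l))\<^sup>2" by simp
      moreover have "(norm (x t - f l))\<^sup>2 = (norm (x t - l))\<^sup>2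
          + 2 * (x t \<bullet> (l - f l) - l \<bullet> (l - f l)) + (norm (l - f l))\<^sup>2"
        by (simp add: power2_norm_eq_inner inner_diff inner_commute algebra_simps)
      ultimately show ?case by linarith
    qed
  qed
  then show ?thesis by simp
qed

lemma nonexpansive_iterates_dist_decseq:
  assumes "nonexpansive f" "w \<in> Fix f"
  shows "decseq (\<lambda>k. norm ((f ^^ k) a - w))"
  unfolding decseq_Suc_iff
proof
  fix k
  have "norm (f ((f ^^ k) a) - f w) \<le> norm ((f ^^ k) a - w)"
    using assms(1) by (simp add: nonexpansive_def)
  then show "norm ((f ^^ Suc k) a - w) \<le> norm ((f ^^ k) a - w)"
    using assms(2) by (simp add: Fix_def)
qed

lemma nonexpansive_iterates_dist_convergent:
  assumes "nonexpansive f" "w \<in> Fix f"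
  shows "convergent (\<lambda>k. norm ((f ^^ k) a - w))"
  using decseq_convergent[OF nonexpansive_iterates_dist_decseq[OF assms], of 0]
  by (metis convergentI norm_ge_zero)

text \<open>
  By demiclosedness every weak cluster point of the iterates is a fixed point.  The distance of the
  iterates to any fixed point converges, so for two cluster points \<open>l\<close> and \<open>w\<close> the inner product of
  the iterates with \<open>l - w\<close> converges as well; comparing its limits along the two refinements gives
  \<open>l = w\<close>.
\<close>

theorem opial_weak_convergence:
  fixes f :: "'a::{real_inner, complete_space} \<Rightarrow> 'a"
  assumes f: "nonexpansive f" and nonempty: "Fix f \<noteq> {}"
    and regular: "(\<lambda>k. (f ^^ k) a - (f ^^ Suc k) a) \<longlonglongrightarrow> 0"
  shows "\<exists>w\<in>Fix f. weakly_tendsto (\<lambda>k. (f ^^ k) a) w sequentially"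
proof -
  let ?x = "\<lambda>k. (f ^^ k) a"
  obtain w0 where w0: "w0 \<in> Fix f" using nonempty by blast
  define B where "B = norm (a - w0) + norm w0"
  have bound: "norm (?x k) \<le> B" for k
  proof -
    have "norm (?x k - w0) \<le> norm (a - w0)"
      using decseqD[OF nonexpansive_iterates_dist_decseq[OF f w0, of a], of 0 k] by simp
    then show ?thesis using norm_triangle_ineq2[of "?x k" w0] by (simp add: B_def)
  qed
  have cluster_fixed: "l \<in> Fix f"
    if "F' \<le> sequentially" "F' \<noteq> bot" "weakly_tendsto ?x l F'" for F' l
  proof -
    have "((\<lambda>k. ?x k - f (?x k)) \<longlongrightarrow> 0) F'"
      using tendsto_mono[OF that(1) regular] by simp
    then have "f l = l"
      using nonexpansive_demiclosed[OF f that(2,3) always_eventually] bound by blast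
    then show ?thesis by (simp add: Fix_def)
  qed
  obtain F0 w where w: "F0 \<le> sequentially" "F0 \<noteq> bot" "weakly_tendsto ?x w F0"
    using bounded_imp_weakly_convergent_refinement[OF sequentially_bot, of ?x B] bound by auto
  have "w \<in> Fix f" using cluster_fixed w by blast
  have "weakly_tendsto ?x w sequentially"
  proof (rule weakly_tendstoI_refinements[of _ B])
    show "eventually (\<lambda>k. norm (?x k) \<le> B) sequentially" using bound by simp
    fix F' l assume l: "F' \<le> sequentially" "F' \<noteq> bot" "weakly_tendsto ?x l F'"
    have "l \<in> Fix f" using cluster_fixed l by blast
    obtain d e where "(\<lambda>k. norm (?x k - w)) \<longlonglongrightarrow> d" "(\<lambda>k. norm (?x k - l)) \<longlonglongrightarrow> e"
      using nonexpansive_iterates_dist_convergent[OF f] \<open>w \<in> Fix f\<close> \<open>l \<in> Fix f\<close>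
      unfolding convergent_def by blast
    then have "(\<lambda>k. ((norm (?x k - w))\<^sup>2 - (norm (?x k - l))\<^sup>2 + l \<bullet> l - w \<bullet> w) / 2)
        \<longlonglongrightarrow> (d\<^sup>2 - e\<^sup>2 + l \<bullet> l - w \<bullet> w) / 2"
      by (intro tendsto_intros) auto
    moreover have "((norm (?x k - w))\<^sup>2 - (norm (?x k - l))\<^sup>2 + l \<bullet> l - w \<bullet> w) / 2
        = ?x k \<bullet> (l - w)" for k
      by (simp add: power2_norm_eq_inner inner_diff inner_commute)
    ultimately have lim: "(\<lambda>k. ?x k \<bullet> (l - w)) \<longlonglongrightarrow> (d\<^sup>2 - e\<^sup>2 + l \<bullet> l - w \<bullet> w) / 2"
      by simp
    have "l \<bullet> (l - w) = (d\<^sup>2 - e\<^sup>2 + l \<bullet> l - w \<bullet> w) / 2"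
      using tendsto_unique[OF l(2)] l(3) tendsto_mono[OF l(1) lim]
      unfolding weakly_tendsto_def by blast
    also have "\<dots> = w \<bullet> (l - w)"
      using tendsto_unique[OF w(2)] w(3) tendsto_mono[OF w(1) lim]
      unfolding weakly_tendsto_def by blast
    finally have "(l - w) \<bullet> (l - w) = 0" by (simp add: inner_diff inner_commute)
    then show "l = w" by simp
  qed
  with \<open>w \<in> Fix f\<close> show ?thesis by blast
qed

section \<open>Compositions of relaxed firmly nonexpansive operators\<close>

lemma firmly_nonexpansive_gap:
  assumes "firmly_nonexpansive f"
  shows "(norm ((u - v) - (f u - f v)))\<^sup>2 \<le> (norm (u - v))\<^sup>2 - (norm (f u - f v))\<^sup>2"
proof -
  have "(norm (f u - f v))\<^sup>2 \<le> (f u - f v) \<bullet> (u - v)"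
    using assms by (simp add: firmly_nonexpansive_def)
  moreover have "(norm (a - b))\<^sup>2 = (norm a)\<^sup>2 - 2 * (b \<bullet> a) + (norm b)\<^sup>2" for a b :: 'a
    by (simp add: power2_norm_eq_inner inner_diff inner_commute)
  ultimately show ?thesis by (smt (verit))
qed

lemma firmly_nonexpansive_relax:
  assumes "firmly_nonexpansive f" "0 \<le> \<epsilon>" "\<epsilon> \<le> 1"
  shows "firmly_nonexpansive (relax \<epsilon> f)"
  unfolding firmly_nonexpansive_def
proof (intro allI)
  fix u v
  define a b where "a = u - v" and "b = (f u - f v) - (u - v)"
  have *: "relax \<epsilon> f u - relax \<epsilon> f v = a + \<epsilon> *\<^sub>R b"
    by (simp add: relax_def a_def b_def algebra_simps)
  have "(norm (a + b))\<^sup>2 \<le> (a + b) \<bullet> a"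
    using assms(1) by (simp add: firmly_nonexpansive_def a_def b_def)
  then have "b \<bullet> b \<le> - (a \<bullet> b)"
    by (simp add: power2_norm_eq_inner inner_add inner_commute)
  moreover have "\<epsilon> * (b \<bullet> b) \<le> b \<bullet> b" using assms by (simp add: mult_left_le_one_le)
  ultimately have "\<epsilon> * (\<epsilon> * (b \<bullet> b)) \<le> \<epsilon> * - (a \<bullet> b)"
    using assms(2) by (intro mult_left_mono) auto
  then have "(norm (a + \<epsilon> *\<^sub>R b))\<^sup>2 \<le> (a + \<epsilon> *\<^sub>R b) \<bullet> a"
    by (simp add: power2_norm_eq_inner inner_add inner_commute)
  then show "(norm (relax \<epsilon> f u - relax \<epsilon> f v))\<^sup>2 \<le> (relax \<epsilon> f u - relax \<epsilon> f v) \<bullet> (u - v)"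
    unfolding * by (simp add: a_def)
qed

lemma cyclic_comp_dist_antimono:
  assumes "\<And>i. i \<in> {1..m} \<Longrightarrow> firmly_nonexpansive (T i)" "0 \<le> \<epsilon>" "\<epsilon> \<le> 1"
    and "i \<le> j" "j \<le> m"
  shows "norm (cyclic_comp T \<epsilon> j u - cyclic_comp T \<epsilon> j v)
    \<le> norm (cyclic_comp T \<epsilon> i u - cyclic_comp T \<epsilon> i v)"
  using assms(4,5)
proof (induction j rule: dec_induct)
  case (step n)
  have "nonexpansive (relax \<epsilon> (T (Suc n)))"
    using step assms(1-3)
    by (intro firmly_nonexpansive_imp_nonexpansive firmly_nonexpansive_relax) auto
  then have "norm (cyclic_comp T \<epsilon> (Suc n) u - cyclic_comp T \<epsilon> (Suc n) v)
      \<le> norm (cyclic_comp T \<epsilon> n u - cyclic_comp T \<epsilon> n v)"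
    by (simp add: nonexpansive_def)
  with step show ?case by simp
qed simp

lemma nonexpansive_cyclic_comp:
  assumes "\<And>i. i \<in> {1..m} \<Longrightarrow> firmly_nonexpansive (T i)" "0 \<le> \<epsilon>" "\<epsilon> \<le> 1"
  shows "nonexpansive (cyclic_comp T \<epsilon> m)"
  using cyclic_comp_dist_antimono[of m T \<epsilon> 0 m] assms by (simp add: nonexpansive_def)

text \<open>
  A composition of \<open>n\<close> firmly nonexpansive operators is averaged.  The step from \<open>n\<close> to \<open>n + 1\<close>
  combines the two gaps by the convexity inequality
  \<open>\<parallel>p + q\<parallel>\<^sup>2 \<le> (n + 1) (\<parallel>p\<parallel>\<^sup>2 / n + \<parallel>q\<parallel>\<^sup>2)\<close>.  It controls how much the displacements
  of two orbits differ by the loss of distance between them, which is summable along the iteration.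
\<close>

lemma cyclic_comp_gap:
  fixes T :: "nat \<Rightarrow> 'a::real_inner \<Rightarrow> 'a"
  assumes "\<And>i. i \<in> {1..n} \<Longrightarrow> firmly_nonexpansive (T i)" "0 \<le> \<epsilon>" "\<epsilon> \<le> 1"
  shows "(norm ((u - v) - (cyclic_comp T \<epsilon> n u - cyclic_comp T \<epsilon> n v)))\<^sup>2
    \<le> real n * ((norm (u - v))\<^sup>2 - (norm (cyclic_comp T \<epsilon> n u - cyclic_comp T \<epsilon> n v))\<^sup>2)"
  using assms(1)
proof (induction n)
  case 0
  then show ?case by simp
next
  case (Suc n)
  (* p and q are the parts of the change of u - v due to the first n factors and to the last one;
     P and Q are the corresponding losses of squared distance. *)
  define D where "D k = cyclic_comp T \<epsilon> k u - cyclic_comp T \<epsilon> k v" for k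
  define p q P Q where "p = D 0 - D n" and "q = D n - D (Suc n)"
    and "P = (norm (D 0))\<^sup>2 - (norm (D n))\<^sup>2" and "Q = (norm (D n))\<^sup>2 - (norm (D (Suc n)))\<^sup>2"
  have D0: "D 0 = u - v" by (simp add: D_def)
  have p: "(norm p)\<^sup>2 \<le> real n * P"
    using Suc by (simp add: p_def P_def D_def)
  have q: "(norm q)\<^sup>2 \<le> Q"
    using firmly_nonexpansive_gap[OF firmly_nonexpansive_relax[OF Suc.prems assms(2,3)], of "Suc n"
        "cyclic_comp T \<epsilon> n u" "cyclic_comp T \<epsilon> n v"]
    by (simp add: q_def Q_def D_def)
  have "(norm (p + q))\<^sup>2 \<le> real (Suc n) * (P + Q)"
  proof (cases "n = 0")
    case True
    then show ?thesis using q by (simp add: p_def P_def)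
  next
    case False
    have "0 \<le> (norm (p - real n *\<^sub>R q))\<^sup>2" by simp
    also have "\<dots> = (norm p)\<^sup>2 + real n * real n * (norm q)\<^sup>2 - 2 * real n * (p \<bullet> q)"
      by (simp add: power2_norm_eq_inner inner_diff inner_commute)
    also have "\<dots> \<le> real n * P + real n * real n * Q - 2 * real n * (p \<bullet> q)"
      using p mult_left_mono[OF q, of "real n * real n"] by simp
    also have "\<dots> = real n * (P + real n * Q - 2 * (p \<bullet> q))" by (simp add: algebra_simps)
    finally have "2 * (p \<bullet> q) \<le> P + real n * Q"
      using False by (simp add: zero_le_mult_iff)
    moreover have "(norm (p + q))\<^sup>2 = (norm p)\<^sup>2 + 2 * (p \<bullet> q) + (norm q)\<^sup>2"
      by (simp add: power2_norm_eq_inner inner_add inner_commute)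
    ultimately show ?thesis using p q by (simp add: algebra_simps)
  qed
  moreover have "p + q = D 0 - D (Suc n)" by (simp add: p_def q_def)
  moreover have "P + Q = (norm (D 0))\<^sup>2 - (norm (D (Suc n)))\<^sup>2" by (simp add: P_def Q_def)
  ultimately show ?case unfolding D0 D_def by simp
qed

lemma cyclic_iteration_eq:
  assumes "\<And>k i. i \<in> {1..m} \<Longrightarrow> y (k * m + i) = relax \<epsilon> (T i) (y (k * m + i - 1))"
    and "i \<le> m"
  shows "y (k * m + i) = cyclic_comp T \<epsilon> i ((cyclic_comp T \<epsilon> m ^^ k) (y 0))"
proof -
  have within: "y (k * m + i) = cyclic_comp T \<epsilon> i (y (k * m))" if "i \<le> m" for k i
    using that
  proof (induction i)
    case (Suc i)
    then show ?case using assms(1)[of "Suc i" k] by simp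
  qed simp
  have "y (k * m) = (cyclic_comp T \<epsilon> m ^^ k) (y 0)"
  proof (induction k)
    case (Suc k)
    then show ?case using within[of m k] by (simp add: add.commute)
  qed simp
  with within[OF assms(2)] show ?thesis by simp
qed

text \<open>
  For a fixed point \<open>w\<close>, the distances from the iterates to \<open>w\<close> converge, so the loss of distance
  over one cycle tends to \<open>0\<close>.  By the gap inequality the displacement produced by the first \<open>i\<close>
  factors at the iterate then approaches the one at \<open>w\<close>.  With \<open>i = m\<close> this is asymptotic regularity,
  and Opial's theorem gives the weak limit \<open>p\<close>; with \<open>w = p\<close> it carries the weak convergence over to
  the intermediate points.
\<close>

proposition cyclic_iteration_weak_limits:
  fixes T :: "nat \<Rightarrow> 'a::{real_inner, complete_space} \<Rightarrow> 'a"
  assumes T: "\<And>i. i \<in> {1..m} \<Longrightarrow> firmly_nonexpansive (T i)"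
    and \<epsilon>: "0 \<le> \<epsilon>" "\<epsilon> \<le> 1"
    and fixpts: "Fix (cyclic_comp T \<epsilon> m) \<noteq> {}"
  shows "\<exists>p\<in>Fix (cyclic_comp T \<epsilon> m). \<forall>i\<le>m.
    weakly_tendsto (\<lambda>k. cyclic_comp T \<epsilon> i ((cyclic_comp T \<epsilon> m ^^ k) a)) (cyclic_comp T \<epsilon> i p) sequentially"
proof -
  define R where "R = cyclic_comp T \<epsilon> m"
  have R: "nonexpansive R"
    unfolding R_def using T \<epsilon> by (rule nonexpansive_cyclic_comp)
  have gap: "(\<lambda>k. ((R ^^ k) a - w) - (cyclic_comp T \<epsilon> i ((R ^^ k) a) - cyclic_comp T \<epsilon> i w))
      \<longlonglongrightarrow> 0" if w: "w \<in> Fix R" and i: "i \<le> m" for w i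
  proof -
    define x where "x k = (R ^^ k) a" for k
    define d where "d k = (norm (x k - w))\<^sup>2" for k
    obtain c where "(\<lambda>k. norm (x k - w)) \<longlonglongrightarrow> c"
      using nonexpansive_iterates_dist_convergent[OF R w, of a]
      unfolding convergent_def x_def by blast
    then have d: "d \<longlonglongrightarrow> c\<^sup>2" unfolding d_def by (intro tendsto_intros)
    have "(\<lambda>k. real m * (d k - d (Suc k))) \<longlonglongrightarrow> real m * (c\<^sup>2 - c\<^sup>2)"
      by (intro tendsto_intros d LIMSEQ_Suc[OF d])
    then have null: "(\<lambda>k. real m * (d k - d (Suc k))) \<longlonglongrightarrow> 0" by simp
    have le: "(norm ((x k - w) - (cyclic_comp T \<epsilon> i (x k) - cyclic_comp T \<epsilon> i w)))\<^sup>2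
        \<le> real m * (d k - d (Suc k))" for k
    proof -
      let ?e = "(norm (cyclic_comp T \<epsilon> i (x k) - cyclic_comp T \<epsilon> i w))\<^sup>2"
      have "(norm ((x k - w) - (cyclic_comp T \<epsilon> i (x k) - cyclic_comp T \<epsilon> i w)))\<^sup>2
          \<le> real i * (d k - ?e)"
        unfolding d_def using T i \<epsilon> by (intro cyclic_comp_gap) auto
      also have "\<dots> \<le> real m * (d k - ?e)"
      proof (rule mult_right_mono)
        have "?e \<le> d k"
          unfolding d_def using cyclic_comp_dist_antimono[of m T \<epsilon> 0 i] T \<epsilon> i
          by (intro power_mono) auto
        then show "0 \<le> d k - ?e" by simp
      qed (use i in simp)
      also have "\<dots> \<le> real m * (d k - d (Suc k))"
      proof -
        have "norm (R (x k) - R w) \<le> norm (cyclic_comp T \<epsilon> i (x k) - cyclic_comp T \<epsilon> i w)"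
          unfolding R_def using T \<epsilon> i by (intro cyclic_comp_dist_antimono[of m]) auto
        then have "d (Suc k) \<le> ?e"
          unfolding d_def using w by (intro power_mono) (auto simp: x_def Fix_def)
        then show ?thesis by (intro mult_left_mono) auto
      qed
      finally show ?thesis .
    qed
    have "(\<lambda>k. (norm ((x k - w) - (cyclic_comp T \<epsilon> i (x k) - cyclic_comp T \<epsilon> i w)))\<^sup>2) \<longlonglongrightarrow> 0"
      by (rule tendsto_sandwich[OF _ _ tendsto_const null]) (use le in auto)
    then have "(\<lambda>k. sqrt ((norm ((x k - w) - (cyclic_comp T \<epsilon> i (x k) - cyclic_comp T \<epsilon> i w)))\<^sup>2))
        \<longlonglongrightarrow> sqrt 0"
      by (rule tendsto_real_sqrt)
    then show ?thesis by (simp add: x_def tendsto_norm_zero_iff)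
  qed
  obtain w0 where w0: "w0 \<in> Fix R" using fixpts by (auto simp: R_def)
  have "(\<lambda>k. (R ^^ k) a - (R ^^ Suc k) a) \<longlonglongrightarrow> 0"
    using gap[OF w0 order_refl] w0 by (simp add: Fix_def flip: R_def)
  then obtain p where p: "p \<in> Fix R" "weakly_tendsto (\<lambda>k. (R ^^ k) a) p sequentially"
    using opial_weak_convergence[OF R] w0 by blast
  have "weakly_tendsto (\<lambda>k. cyclic_comp T \<epsilon> i ((R ^^ k) a)) (cyclic_comp T \<epsilon> i p) sequentially" if "i \<le> m" for i
  proof -
    have "(\<lambda>k. - (((R ^^ k) a - p) - (cyclic_comp T \<epsilon> i ((R ^^ k) a) - cyclic_comp T \<epsilon> i p))
        + (cyclic_comp T \<epsilon> i p - p)) \<longlonglongrightarrow> - 0 + (cyclic_comp T \<epsilon> i p - p)"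
      by (intro tendsto_intros gap p that)
    then have "(\<lambda>k. cyclic_comp T \<epsilon> i ((R ^^ k) a) - (R ^^ k) a) \<longlonglongrightarrow> cyclic_comp T \<epsilon> i p - p"
      by (simp add: algebra_simps)
    from weakly_tendsto_strong_perturbation[OF p(2) this] show ?thesis by simp
  qed
  with p(1) show ?thesis by (auto simp: R_def)
qed

section \<open>Expansion of the composition for small relaxation parameters\<close>

lemma cyclic_comp_displacement:
  fixes T :: "nat \<Rightarrow> 'a::real_inner \<Rightarrow> 'a"
  assumes "\<And>i. i \<in> {1..n} \<Longrightarrow> nonexpansive (T i)"
  shows "\<exists>K\<ge>0. \<forall>\<epsilon>\<in>{0..1}. \<forall>v. norm v \<le> M \<longrightarrow> norm (cyclic_comp T \<epsilon> n v - v) \<le> K * \<epsilon>"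
  using assms
proof (induction n)
  case 0
  then show ?case by (auto intro!: exI[of _ 0])
next
  case (Suc n)
  then obtain K where K: "K \<ge> 0" "\<And>\<epsilon> v. \<epsilon> \<in> {0..1} \<Longrightarrow> norm v \<le> M
      \<Longrightarrow> norm (cyclic_comp T \<epsilon> n v - v) \<le> K * \<epsilon>" by force
  define a where "a = norm (T (Suc n) 0)"
  have "norm (cyclic_comp T \<epsilon> (Suc n) v - v) \<le> (K + (2 * (\<bar>M\<bar> + K) + a)) * \<epsilon>"
    if "\<epsilon> \<in> {0..1}" "norm v \<le> M" for \<epsilon> v
  proof -
    define c where "c = cyclic_comp T \<epsilon> n v"
    have "K * \<epsilon> \<le> K" using K(1) that(1) by (simp add: mult_left_le)
    then have "norm (c - v) \<le> K" using K(2)[OF that] by (simp add: c_def)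
    then have "norm c \<le> \<bar>M\<bar> + K" using that norm_triangle_sub[of c v] by simp
    moreover have "norm (T (Suc n) c - T (Suc n) 0) \<le> norm c"
      using Suc.prems[of "Suc n"] by (simp add: nonexpansive_def) (metis diff_zero)
    then have "norm (T (Suc n) c - c) \<le> 2 * norm c + a"
      using norm_triangle_sub[of "T (Suc n) c" "T (Suc n) 0"] norm_triangle_ineq4[of "T (Suc n) c" c]
      by (simp add: a_def)
    ultimately have "norm (\<epsilon> *\<^sub>R (T (Suc n) c - c)) \<le> \<epsilon> * (2 * (\<bar>M\<bar> + K) + a)"
      using that(1) by (auto intro!: mult_left_mono)
    moreover have "cyclic_comp T \<epsilon> (Suc n) v - v = (c - v) + \<epsilon> *\<^sub>R (T (Suc n) c - c)"
      by (simp add: relax_def c_def)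
    ultimately show ?thesis
      using norm_triangle_ineq[of "c - v" "\<epsilon> *\<^sub>R (T (Suc n) c - c)"] K(2)[OF that]
      unfolding c_def by (smt (verit, best) distrib_right mult.commute)
  qed
  moreover have "0 \<le> K + (2 * (\<bar>M\<bar> + K) + a)" using K(1) by (simp add: a_def)
  ultimately show ?case by blast
qed

text \<open>
  The factor with index \<open>n + 1\<close> acts at a point that is \<open>O(\<epsilon>)\<close> away from \<open>v\<close>, so evaluating its
  displacement at \<open>v\<close> instead changes the result by \<open>\<epsilon> O(\<epsilon>)\<close> only.
\<close>

lemma cyclic_comp_first_order:
  fixes T :: "nat \<Rightarrow> 'a::real_inner \<Rightarrow> 'a"
  assumes "\<And>i. i \<in> {1..n} \<Longrightarrow> nonexpansive (T i)"
  shows "\<exists>K. \<forall>\<epsilon>\<in>{0..1}. \<forall>v. norm v \<le> M \<longrightarrow>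
    norm (cyclic_comp T \<epsilon> n v - v - \<epsilon> *\<^sub>R (\<Sum>i\<in>{1..n}. T i v - v)) \<le> K * \<epsilon>\<^sup>2"
  using assms
proof (induction n)
  case 0
  then show ?case by (auto intro!: exI[of _ 0])
next
  case (Suc n)
  then obtain K where K: "\<And>\<epsilon> v. \<epsilon> \<in> {0..1} \<Longrightarrow> norm v \<le> M
      \<Longrightarrow> norm (cyclic_comp T \<epsilon> n v - v - \<epsilon> *\<^sub>R (\<Sum>i\<in>{1..n}. T i v - v)) \<le> K * \<epsilon>\<^sup>2" by force
  obtain L where L: "\<And>\<epsilon> v. \<epsilon> \<in> {0..1} \<Longrightarrow> norm v \<le> M
      \<Longrightarrow> norm (cyclic_comp T \<epsilon> n v - v) \<le> L * \<epsilon>"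
    using cyclic_comp_displacement[of n T M] Suc.prems by force
  have "norm (cyclic_comp T \<epsilon> (Suc n) v - v - \<epsilon> *\<^sub>R (\<Sum>i\<in>{1..Suc n}. T i v - v))
      \<le> (K + 2 * L) * \<epsilon>\<^sup>2"
    if "\<epsilon> \<in> {0..1}" "norm v \<le> M" for \<epsilon> v
  proof -
    define c where "c = cyclic_comp T \<epsilon> n v"
    (* A is the error after n factors; B is the change of the displacement of the last factor
       between v and the point c where it acts. *)
    define A where "A = c - v - \<epsilon> *\<^sub>R (\<Sum>i\<in>{1..n}. T i v - v)"
    define B where "B = (T (Suc n) c - T (Suc n) v) - (c - v)"
    have "norm (T (Suc n) c - T (Suc n) v) \<le> norm (c - v)"
      using Suc.prems[of "Suc n"] by (simp add: nonexpansive_def)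
    then have "norm B \<le> 2 * norm (c - v)"
      using norm_triangle_ineq4[of "T (Suc n) c - T (Suc n) v" "c - v"] by (simp add: B_def)
    also have "\<dots> \<le> 2 * (L * \<epsilon>)" using L[OF that] by (simp add: c_def)
    finally have "norm (\<epsilon> *\<^sub>R B) \<le> \<epsilon> * (2 * (L * \<epsilon>))"
      using that(1) by (auto intro!: mult_left_mono)
    moreover have "norm A \<le> K * \<epsilon>\<^sup>2" using K[OF that] by (simp add: A_def c_def)
    moreover have "cyclic_comp T \<epsilon> (Suc n) v - v - \<epsilon> *\<^sub>R (\<Sum>i\<in>{1..Suc n}. T i v - v) = A + \<epsilon> *\<^sub>R B"
      by (simp add: relax_def A_def B_def algebra_simps flip: c_def)
    ultimately show ?thesis
      using norm_triangle_ineq[of A "\<epsilon> *\<^sub>R B"] by (simp add: power2_eq_square algebra_simps)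
  qed
  then show ?case by blast
qed

section \<open>Minimizers of the sum of squared distances\<close>

text \<open>
  Half the squared distance is convex with gradient \<open>Id - P\<close>; its subgradient inequality
  holds with an extra quadratic term, which later shows that the residual \<open>Id - P\<close> takes only one
  value on a set of minimizers.
\<close>

lemma infdist_sq_ge_linearization:
  fixes C :: "'a::{real_inner, complete_space} set"
  assumes "C \<noteq> {}" "closed C" "convex C"
  shows "(infdist w C)\<^sup>2 + 2 * ((w - metric_proj C w) \<bullet> (v - w))
      + (norm ((v - metric_proj C v) - (w - metric_proj C w)))\<^sup>2 \<le> (infdist v C)\<^sup>2"
proof -
  define r s where "r = w - metric_proj C w" and "s = v - metric_proj C v"
  have "r \<bullet> (metric_proj C v - metric_proj C w) \<le> 0"
    unfolding r_def using assms by (simp add: metric_proj_inner_le metric_proj_in)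
  moreover have "metric_proj C v - metric_proj C w = (v - w) - (s - r)"
    by (simp add: r_def s_def)
  ultimately have "r \<bullet> (v - w) \<le> r \<bullet> (s - r)" by (simp add: inner_diff_right)
  moreover have "(norm s)\<^sup>2 = (norm r)\<^sup>2 + 2 * (r \<bullet> (s - r)) + (norm (s - r))\<^sup>2"
    by (simp add: power2_norm_eq_inner inner_diff inner_commute)
  moreover have "infdist w C = norm r" "infdist v C = norm s"
    using assms by (simp_all add: r_def s_def dist_norm flip: dist_metric_proj)
  ultimately show ?thesis unfolding r_def[symmetric] s_def[symmetric] by simp
qed

text \<open>
  Minimizers are the fixed points of the mean of the projections.  Moving \<open>w\<close> to that mean lowers the
  sum, which proves one direction; the other one sums the subgradient inequalities.
\<close>

lemma sum_infdist_sq_minimal_iff: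
  fixes C :: "'i \<Rightarrow> 'a::{real_inner, complete_space} set"
  assumes I: "finite I" and C: "\<And>i. i \<in> I \<Longrightarrow> C i \<noteq> {} \<and> closed (C i) \<and> convex (C i)"
  shows "(\<forall>v. (\<Sum>i\<in>I. (infdist w (C i))\<^sup>2) \<le> (\<Sum>i\<in>I. (infdist v (C i))\<^sup>2))
    \<longleftrightarrow> (\<Sum>i\<in>I. metric_proj (C i) w - w) = 0"
    (is "?min \<longleftrightarrow> ?g = 0")
proof
  assume ?min
  show "?g = 0"
  proof (cases "I = {}")
    case False
    define n where "n = real (card I)"
    have n: "n > 0" using False I by (simp add: n_def card_gt_0_iff)
    (* the mean of the projections of w *)
    define v where "v = w + (1 / n) *\<^sub>R ?g"
    have sum_affine: "(\<Sum>i\<in>I. a i - c * (q i \<bullet> g) + k) = sum a I - c * (sum q I \<bullet> g) + n * k"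
      for a c k g and q :: "'i \<Rightarrow> 'a"
      by (simp add: sum.distrib sum_subtractf inner_sum_left sum_distrib_left n_def)
    have "(\<Sum>i\<in>I. (infdist w (C i))\<^sup>2) \<le> (\<Sum>i\<in>I. (infdist v (C i))\<^sup>2)"
      using \<open>?min\<close> by blast
    also have "\<dots> \<le> (\<Sum>i\<in>I. (norm (v - metric_proj (C i) w))\<^sup>2)"
    proof (intro sum_mono power_mono)
      fix i assume "i \<in> I"
      then show "infdist v (C i) \<le> norm (v - metric_proj (C i) w)"
        using C[of i] metric_proj_in[of "C i" w] by (simp add: infdist_le flip: dist_norm)
    qed (rule infdist_nonneg)
    also have "\<dots> = (\<Sum>i\<in>I. (infdist w (C i))\<^sup>2
        - (2 / n) * ((metric_proj (C i) w - w) \<bullet> ?g) + (1 / n)\<^sup>2 * (?g \<bullet> ?g))"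
    proof (rule sum.cong)
      fix i assume "i \<in> I"
      define q where "q = metric_proj (C i) w - w"
      have "(infdist w (C i))\<^sup>2 = q \<bullet> q"
        using C[OF \<open>i \<in> I\<close>]
        by (simp add: q_def dist_norm norm_minus_commute flip: dist_metric_proj power2_norm_eq_inner)
      moreover have "v - metric_proj (C i) w = (1 / n) *\<^sub>R ?g - q" by (simp add: v_def q_def)
      moreover have "(norm ((1 / n) *\<^sub>R g - q))\<^sup>2
          = q \<bullet> q - (2 / n) * (q \<bullet> g) + (1 / n)\<^sup>2 * (g \<bullet> g)" for g
        unfolding power2_norm_eq_inner by (simp add: inner_diff inner_commute power2_eq_square)
      ultimately show "(norm (v - metric_proj (C i) w))\<^sup>2 = (infdist w (C i))\<^sup>2
          - (2 / n) * ((metric_proj (C i) w - w) \<bullet> ?g) + (1 / n)\<^sup>2 * (?g \<bullet> ?g)"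
        unfolding q_def[symmetric] by simp
    qed simp
    also have "\<dots> = (\<Sum>i\<in>I. (infdist w (C i))\<^sup>2) - (2 / n) * (?g \<bullet> ?g) + n * ((1 / n)\<^sup>2 * (?g \<bullet> ?g))"
      by (rule sum_affine)
    also have "\<dots> = (\<Sum>i\<in>I. (infdist w (C i))\<^sup>2) - (?g \<bullet> ?g) / n"
      using n by (simp add: field_simps power2_eq_square)
    finally have "?g \<bullet> ?g \<le> 0" using n by (simp add: divide_le_0_iff)
    then show ?thesis by (meson inner_eq_zero_iff inner_ge_zero order_antisym)
  qed simp
next
  assume g: "?g = 0"
  show ?min
  proof
    fix v
    have "(\<Sum>i\<in>I. (infdist w (C i))\<^sup>2) = (\<Sum>i\<in>I. (infdist w (C i))\<^sup>2) - 2 * (?g \<bullet> (v - w))"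
      using g by simp
    also have "\<dots> = (\<Sum>i\<in>I. (infdist w (C i))\<^sup>2 + 2 * ((w - metric_proj (C i) w) \<bullet> (v - w)))"
      by (simp add: sum.distrib sum_subtractf inner_sum_left inner_diff_left sum_distrib_left algebra_simps)
    also have "\<dots> \<le> (\<Sum>i\<in>I. (infdist v (C i))\<^sup>2)"
    proof (rule sum_mono)
      fix i assume "i \<in> I"
      then have "(infdist w (C i))\<^sup>2 + 2 * ((w - metric_proj (C i) w) \<bullet> (v - w))
          + (norm ((v - metric_proj (C i) v) - (w - metric_proj (C i) w)))\<^sup>2 \<le> (infdist v (C i))\<^sup>2"
        using C by (intro infdist_sq_ge_linearization) auto
      then show "(infdist w (C i))\<^sup>2 + 2 * ((w - metric_proj (C i) w) \<bullet> (v - w))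
          \<le> (infdist v (C i))\<^sup>2"
        by (smt (verit) zero_le_power2)
    qed
    finally show "(\<Sum>i\<in>I. (infdist w (C i))\<^sup>2) \<le> (\<Sum>i\<in>I. (infdist v (C i))\<^sup>2)" .
  qed
qed

text \<open>
  Summing the strengthened subgradient inequality between two minimizers, the linear terms cancel and
  the two sums of squared distances agree, so the quadratic terms must vanish.
\<close>

lemma residual_eq_if_sum_infdist_sq_minimal:
  fixes C :: "'i \<Rightarrow> 'a::{real_inner, complete_space} set"
  assumes I: "finite I" and C: "\<And>i. i \<in> I \<Longrightarrow> C i \<noteq> {} \<and> closed (C i) \<and> convex (C i)"
    and v: "\<And>u. (\<Sum>i\<in>I. (infdist v (C i))\<^sup>2) \<le> (\<Sum>i\<in>I. (infdist u (C i))\<^sup>2)"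
    and w: "\<And>u. (\<Sum>i\<in>I. (infdist w (C i))\<^sup>2) \<le> (\<Sum>i\<in>I. (infdist u (C i))\<^sup>2)"
    and "j \<in> I"
  shows "v - metric_proj (C j) v = w - metric_proj (C j) w"
proof -
  define r where "r u i = u - metric_proj (C i) u" for u i
  have "(\<Sum>i\<in>I. metric_proj (C i) w - w) = 0"
    using sum_infdist_sq_minimal_iff[of I C w] I C w by blast
  then have "(\<Sum>i\<in>I. r w i) = 0" by (simp add: r_def sum_subtractf)
  then have zero: "(\<Sum>i\<in>I. r w i \<bullet> (v - w)) = 0" by (simp flip: inner_sum_left)
  have "(\<Sum>i\<in>I. (infdist w (C i))\<^sup>2 + 2 * (r w i \<bullet> (v - w)) + (norm (r v i - r w i))\<^sup>2)
      \<le> (\<Sum>i\<in>I. (infdist v (C i))\<^sup>2)"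
    unfolding r_def using C by (intro sum_mono infdist_sq_ge_linearization) auto
  then have "(\<Sum>i\<in>I. (norm (r v i - r w i))\<^sup>2) \<le> 0"
    using zero v[of w] by (simp add: sum.distrib flip: sum_distrib_left)
  then have "(\<Sum>i\<in>I. (norm (r v i - r w i))\<^sup>2) = 0"
    by (intro antisym sum_nonneg) auto
  then have "(norm (r v j - r w j))\<^sup>2 = 0"
    using I \<open>j \<in> I\<close> by (subst (asm) sum_nonneg_eq_0_iff) auto
  then show ?thesis by (simp add: r_def)
qed

text \<open>
  Since the residual is constant on the line, the projection of \<open>z + t e\<close> onto \<open>C\<^sub>j\<close> is the one of \<open>z\<close>
  moved by \<open>t e\<close>.  So \<open>C\<^sub>j\<close> contains a line in direction \<open>e\<close>, and the variational
  inequality at an arbitrary \<open>v\<close>, tested along that line, bounds an affine function of \<open>t\<close> from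
  above; its slope vanishes.
\<close>

lemma residual_orthogonal_to_minimal_line:
  fixes C :: "'i \<Rightarrow> 'a::{real_inner, complete_space} set"
  assumes I: "finite I" and C: "\<And>i. i \<in> I \<Longrightarrow> C i \<noteq> {} \<and> closed (C i) \<and> convex (C i)"
    and line: "\<And>t u. (\<Sum>i\<in>I. (infdist (z + t *\<^sub>R e) (C i))\<^sup>2) \<le> (\<Sum>i\<in>I. (infdist u (C i))\<^sup>2)"
    and "j \<in> I"
  shows "(metric_proj (C j) v - v) \<bullet> e = 0"
proof (rule ccontr)
  define r where "r = v - metric_proj (C j) v"
  define a where "a = r \<bullet> (metric_proj (C j) z - metric_proj (C j) v)"
  assume "(metric_proj (C j) v - v) \<bullet> e \<noteq> 0"
  then have re: "r \<bullet> e \<noteq> 0" by (simp add: r_def inner_diff_left)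
  have C': "C j \<noteq> {}" "closed (C j)" "convex (C j)" using C \<open>j \<in> I\<close> by blast+
  have "a + t * (r \<bullet> e) \<le> 0" for t
  proof -
    have "(z + t *\<^sub>R e) - metric_proj (C j) (z + t *\<^sub>R e) = z - metric_proj (C j) z"
      using line line[of 0] \<open>j \<in> I\<close>
      by (intro residual_eq_if_sum_infdist_sq_minimal[OF I C]) auto
    then have "metric_proj (C j) z + t *\<^sub>R e = metric_proj (C j) (z + t *\<^sub>R e)"
      by (simp add: algebra_simps)
    then have "metric_proj (C j) z + t *\<^sub>R e \<in> C j" using metric_proj_in[OF C'] by simp
    from metric_proj_inner_le[OF C' this, of v] show ?thesis
      by (simp add: r_def a_def inner_add_right inner_diff_right algebra_simps)
  qed
  (* this t makes the affine function equal to 1 *)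
  from this[of "(1 - a) / (r \<bullet> e)"] show False using re by simp
qed

section \<open>Limits of the cycles\<close>

lemma cyclic_comp_inner_invariant:
  assumes "\<And>i v. i \<in> {1..n} \<Longrightarrow> (T i v - v) \<bullet> e = 0"
  shows "cyclic_comp T \<epsilon> n v \<bullet> e = v \<bullet> e"
  using assms by (induction n) (simp_all add: relax_def inner_add_left)

lemma nonexpansive_mean:
  assumes "\<And>i. i \<in> I \<Longrightarrow> nonexpansive (T i)"
  shows "nonexpansive (\<lambda>v. (1 / real (card I)) *\<^sub>R (\<Sum>i\<in>I. T i v))"
  unfolding nonexpansive_def
proof (intro allI)
  fix u v
  have "norm (\<Sum>i\<in>I. T i u - T i v) \<le> real (card I) * norm (u - v)"
    using assms by (intro sum_norm_bound) (simp add: nonexpansive_def)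
  then have "norm (\<Sum>i\<in>I. T i u - T i v) / real (card I) \<le> norm (u - v)"
    by (cases "card I = 0") (simp_all add: field_simps)
  then show "norm ((1 / real (card I)) *\<^sub>R (\<Sum>i\<in>I. T i u) - (1 / real (card I)) *\<^sub>R (\<Sum>i\<in>I. T i v))
      \<le> norm (u - v)"
    by (simp add: sum_subtractf flip: scaleR_diff_right)
qed

text \<open>
  The contraction is only assumed for vectors of norm at most \<open>\<delta>\<close>.  Farther out, nonexpansiveness carries
  over the gain made at the point at distance \<open>\<delta>\<close> on the same ray.  Consequently a small residual
  forces \<open>v\<close> to be small even if \<open>v\<close> is not known to be close to \<open>0\<close>.
\<close>

lemma residual_lower_bound_of_local_contraction:
  fixes f :: "'a::real_normed_vector \<Rightarrow> 'a"
  assumes f: "nonexpansive f" and s: "f s = s" and "subspace V" "v \<in> V" "\<delta> > 0"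
    and contr: "\<And>u. u \<in> V \<Longrightarrow> norm u \<le> \<delta> \<Longrightarrow> norm (f (u + s) - s) \<le> \<rho> * norm u"
  shows "(1 - \<rho>) * min (norm v) \<delta> \<le> norm ((v + s) - f (v + s))"
proof -
  (* the nearest point to v in the ball of radius \<delta> *)
  define u where "u = (if norm v \<le> \<delta> then v else (\<delta> / norm v) *\<^sub>R v)"
  have u: "u \<in> V" "norm u = min (norm v) \<delta>" "norm (v - u) = norm v - norm u"
  proof -
    show "u \<in> V" using assms(3,4) by (simp add: u_def subspace_scale)
    show *: "norm u = min (norm v) \<delta>" using \<open>\<delta> > 0\<close> by (auto simp: u_def)
    show "norm (v - u) = norm v - norm u"
    proof (cases "norm v \<le> \<delta>")
      case False
      then have "norm v > 0" using \<open>\<delta> > 0\<close> by linarith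
      from False have "v - u = (1 - \<delta> / norm v) *\<^sub>R v" by (simp add: u_def scaleR_left_diff_distrib)
      then have "norm (v - u) = \<bar>1 - \<delta> / norm v\<bar> * norm v" by simp
      also have "\<dots> = norm v - \<delta>"
        using False \<open>\<delta> > 0\<close> \<open>norm v > 0\<close> by (simp add: field_simps)
      finally show ?thesis using * False by simp
    qed (simp add: u_def)
  qed
  have "norm (f (v + s) - f (u + s)) \<le> norm (v - u)"
    using f unfolding nonexpansive_def by (metis add_diff_cancel_right)
  moreover have "norm u \<le> \<delta>" using u(2) by simp
  then have "norm (f (u + s) - s) \<le> \<rho> * norm u" by (rule contr[OF u(1)])
  moreover have "norm (f (v + s) - s) \<le> norm (f (v + s) - f (u + s)) + norm (f (u + s) - s)"
    using norm_triangle_ineq[of "f (v + s) - f (u + s)" "f (u + s) - s"] by simp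
  moreover have "norm v \<le> norm ((v + s) - f (v + s)) + norm (f (v + s) - s)"
    using norm_triangle_ineq[of "(v + s) - f (v + s)" "f (v + s) - s"] by simp
  ultimately have "norm u - \<rho> * norm u \<le> norm ((v + s) - f (v + s))"
    using u(3) by linarith
  then show ?thesis using u(2) by (simp add: algebra_simps)
qed

theorem corollary3p9:
  fixes C :: "nat \<Rightarrow> 'a::{real_inner, complete_space} set"
    and T :: "nat \<Rightarrow> 'a \<Rightarrow> 'a"
    and Tbar :: "'a \<Rightarrow> 'a"
    and R :: "real \<Rightarrow> 'a \<Rightarrow> 'a"
    and \<Phi> :: "'a \<Rightarrow> real"
    and S E :: "'a set"
    and z y0 xbar :: 'a
    and y :: "real \<Rightarrow> nat \<Rightarrow> 'a"
    and x :: "real \<Rightarrow> nat \<Rightarrow> 'a"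
    and m :: nat and \<eta> \<beta> :: real
  assumes m: "m \<ge> 2"
    and C: "\<And>i. i \<in> {1..m} \<Longrightarrow> C i \<noteq> {} \<and> closed (C i) \<and> convex (C i)"
    and T: "\<And>i. i \<in> {1..m} \<Longrightarrow> T i = metric_proj (C i)"
    and Tbar: "Tbar = (\<lambda>v. (1 / real m) *\<^sub>R (\<Sum>i\<in>{1..m}. T i v))"
    and R: "\<And>\<epsilon>. \<epsilon> \<in> {0<..<1} \<Longrightarrow> R \<epsilon> = cyclic_comp T \<epsilon> m"
    and \<eta>: "\<eta> \<in> {0<..1}"
    and \<beta>: "\<beta> > 0"
    and fixpts: "\<And>\<epsilon>. \<epsilon> \<in> {0<..<\<eta>} \<Longrightarrow> \<exists>w \<in> Fix (R \<epsilon>). norm w \<le> \<beta>"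
    and \<Phi>: "\<Phi> = (\<lambda>v. (1 / (2 * real m)) * (\<Sum>i\<in>{1..m}. (infdist v (C i))\<^sup>2))"
    and S: "S = {v. is_arg_min \<Phi> (\<lambda>_. True) v}"
    and E: "subspace E" "closed E"
    and SE: "S = (\<lambda>e. z + e) ` E"
    and xbar: "xbar = metric_proj S y0"
    and y_0: "\<And>\<epsilon>. \<epsilon> \<in> {0<..<\<eta>} \<Longrightarrow> y \<epsilon> 0 = y0"
    and y_step: "\<And>\<epsilon> k i. \<epsilon> \<in> {0<..<\<eta>} \<Longrightarrow> i \<in> {1..m} \<Longrightarrow>
           y \<epsilon> (k * m + i) = relax \<epsilon> (T i) (y \<epsilon> (k * m + i - 1))"
    and x: "\<And>\<epsilon> i. \<epsilon> \<in> {0<..<\<eta>} \<Longrightarrow> i \<in> {1..m} \<Longrightarrow>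
           x \<epsilon> i = weak_Lim sequentially (\<lambda>k. y \<epsilon> (k * m + i))"
  shows "(\<forall>i\<in>{1..m}. weakly_tendsto (\<lambda>\<epsilon>. x \<epsilon> i) xbar (at_right 0)) \<and>
         ((\<forall>s\<in>S. \<exists>\<rho>\<in>{0..<1}. \<exists>\<delta>>0. \<forall>v \<in> cball 0 \<delta> \<inter> E\<^sup>\<bottom>.
              norm (Tbar (v + s) - Tbar s) \<le> \<rho> * norm v) \<longrightarrow>
          (\<forall>i\<in>{1..m}. ((\<lambda>\<epsilon>. x \<epsilon> i) \<longlongrightarrow> xbar) (at_right 0)))"
proof -
  let ?F = "at_right (0::real)"
  let ?I = "{1..m}"
  define d where "d v = (\<Sum>i\<in>?I. (infdist v (C i))\<^sup>2)" for v
  have firm: "firmly_nonexpansive (T i)" if "i \<in> ?I" for i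
    using T[OF that] C[OF that] by (simp add: firmly_nonexpansive_metric_proj)
  then have nonexp: "nonexpansive (T i)" if "i \<in> ?I" for i
    using that by (blast intro: firmly_nonexpansive_imp_nonexpansive)
  have Tbar_nonexp: "nonexpansive Tbar"
    using nonexpansive_mean[of ?I T, OF nonexp] by (simp add: Tbar)
  have residual: "Tbar v - v = (1 / real m) *\<^sub>R (\<Sum>i\<in>?I. T i v - v)" for v
    using m by (simp add: Tbar sum_subtractf scaleR_diff_right sum_constant_scaleR)
  have "\<Phi> v = d v / (2 * real m)" for v by (simp add: \<Phi> d_def)
  then have S_min: "w \<in> S \<longleftrightarrow> (\<forall>v. d w \<le> d v)" for w
    using m by (simp add: S is_arg_min_linorder divide_le_cancel)
  have S_fix: "w \<in> S \<longleftrightarrow> Tbar w = w" for w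
  proof -
    have "(\<Sum>i\<in>?I. T i w - w) = (\<Sum>i\<in>?I. metric_proj (C i) w - w)"
      using T by (intro sum.cong) auto
    then have "w \<in> S \<longleftrightarrow> (\<Sum>i\<in>?I. T i w - w) = 0"
      using sum_infdist_sq_minimal_iff[of ?I C w] C by (simp add: S_min d_def)
    also have "\<dots> \<longleftrightarrow> Tbar w - w = 0" using m by (simp add: residual)
    finally show ?thesis by simp
  qed
  have orth: "(T i v - v) \<bullet> e = 0" if "e \<in> E" "i \<in> ?I" for i v e
  proof -
    have "z + t *\<^sub>R e \<in> S" for t using that(1) E(1) by (simp add: SE subspace_scale)
    then have "(metric_proj (C i) v - v) \<bullet> e = 0"
      using that(2) S_min C
      by (intro residual_orthogonal_to_minimal_line[of ?I C z]) (auto simp: d_def)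
    then show ?thesis by (simp add: T[OF that(2)])
  qed

  have S_props: "S \<noteq> {}" "closed S" "convex S"
    using E subspace_0[OF E(1)]
    by (auto simp: SE closed_translation convex_translation subspace_imp_convex)
  have S_add: "s + e \<in> S" if "s \<in> S" "e \<in> E" for s e
    using that subspace_add[OF E(1)] by (auto simp: SE add.assoc)
  have S_diff: "s - s' \<in> E" if "s \<in> S" "s' \<in> S" for s s'
    using that subspace_diff[OF E(1)] by (auto simp: SE)
  have xbar_S: "xbar \<in> S" using metric_proj_in[OF S_props] by (simp add: xbar)
  have xbar_orth: "y0 \<bullet> e = xbar \<bullet> e" if "e \<in> E" for e
  proof -
    have "xbar + e \<in> S" "xbar + (- e) \<in> S"
      using S_add[OF xbar_S] that subspace_neg[OF E(1)] by blast+
    from this[THEN metric_proj_inner_le[OF S_props, of _ y0]] show ?thesis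
      by (simp add: inner_diff_left flip: xbar)
  qed

  have ev: "eventually P ?F" if "\<And>\<epsilon>. \<epsilon> \<in> {0<..<\<eta>} \<Longrightarrow> P \<epsilon>" for P
    using that \<eta> by (intro eventually_at_rightI[of 0 \<eta>]) auto
  have null: "(g \<longlongrightarrow> 0) ?F"
    if "\<And>\<epsilon>. \<epsilon> \<in> {0<..<\<eta>} \<Longrightarrow> norm (g \<epsilon>) \<le> K * \<epsilon>" for g :: "real \<Rightarrow> 'a" and K
  proof (rule Lim_null_comparison)
    show "eventually (\<lambda>\<epsilon>. norm (g \<epsilon>) \<le> K * \<epsilon>) ?F" using that by (rule ev)
    have "((\<lambda>\<epsilon>. K * \<epsilon>) \<longlongrightarrow> K * 0) ?F" by (intro tendsto_intros)
    then show "((\<lambda>\<epsilon>. K * \<epsilon>) \<longlongrightarrow> 0) ?F" by simp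
  qed
  have \<epsilon>01: "0 \<le> \<epsilon>" "\<epsilon> \<le> 1" "\<epsilon> \<in> {0<..<1}" "\<epsilon> \<in> {0..1}" if "\<epsilon> \<in> {0<..<\<eta>}" for \<epsilon>
    using that \<eta> by auto
  (* p is within norm (y0 - w) of a fixed point w of norm at most \<beta>, by Fejer monotonicity *)
  define M where "M = norm y0 + 2 * \<beta>"
  (* p is the weak limit with index m; the images of p under the first i factors are the others.
     The inner products with elements of E are invariant along the iteration. *)
  have "\<exists>p\<in>Fix (cyclic_comp T \<epsilon> m). norm p \<le> M \<and> (\<forall>e\<in>E. p \<bullet> e = y0 \<bullet> e)
      \<and> (\<forall>i\<in>?I. x \<epsilon> i = cyclic_comp T \<epsilon> i p)" if \<epsilon>: "\<epsilon> \<in> {0<..<\<eta>}" for \<epsilon>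
  proof -
    let ?R = "cyclic_comp T \<epsilon> m"
    have R_nonexp: "nonexpansive ?R"
      using firm \<epsilon>01[OF \<epsilon>] by (intro nonexpansive_cyclic_comp)
    obtain w where w: "w \<in> Fix ?R" "norm w \<le> \<beta>"
      using fixpts[OF \<epsilon>] R[OF \<epsilon>01(3)[OF \<epsilon>]] by auto
    then obtain p where p: "p \<in> Fix ?R" and weak: "\<And>i. i \<le> m \<Longrightarrow>
        weakly_tendsto (\<lambda>k. cyclic_comp T \<epsilon> i ((?R ^^ k) y0)) (cyclic_comp T \<epsilon> i p) sequentially"
      using cyclic_iteration_weak_limits[of m T \<epsilon> y0, OF firm \<epsilon>01(1,2)[OF \<epsilon>]] by blast
    have weak0: "weakly_tendsto (\<lambda>k. (?R ^^ k) y0) p sequentially"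
      using weak[of 0] by simp
    have "norm (p - w) \<le> norm (y0 - w)"
    proof (rule weakly_tendsto_norm_diff_le[OF weak0 sequentially_bot always_eventually], rule)
      show "norm ((?R ^^ k) y0 - w) \<le> norm (y0 - w)" for k
        using decseqD[OF nonexpansive_iterates_dist_decseq[OF R_nonexp w(1), of y0], of 0 k] by simp
    qed
    then have "norm p \<le> M"
      using w(2) norm_triangle_ineq4[of y0 w] norm_triangle_sub[of p w] by (simp add: M_def)
    moreover have "p \<bullet> e = y0 \<bullet> e" if "e \<in> E" for e
    proof -
      have "?R v \<bullet> e = v \<bullet> e" for v
        using orth[OF that] by (rule cyclic_comp_inner_invariant)
      then have "((?R ^^ k) y0) \<bullet> e = y0 \<bullet> e" for k by (induction k) simp_all
      moreover have "(\<lambda>k. ((?R ^^ k) y0) \<bullet> e) \<longlonglongrightarrow> p \<bullet> e"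
        using weak0 by (simp add: weakly_tendsto_def)
      ultimately have "(\<lambda>k::nat. y0 \<bullet> e) \<longlonglongrightarrow> p \<bullet> e" by simp
      then show ?thesis using LIMSEQ_unique tendsto_const by blast
    qed
    moreover have "x \<epsilon> i = cyclic_comp T \<epsilon> i p" if "i \<in> ?I" for i
    proof -
      have "y \<epsilon> (k * m + i) = cyclic_comp T \<epsilon> i ((?R ^^ k) y0)" for k
        using cyclic_iteration_eq[of m "y \<epsilon>" \<epsilon> T i k] y_step[OF \<epsilon>] y_0[OF \<epsilon>] that by simp
      then show ?thesis
        using x[OF \<epsilon> that] weak[of i] that by (simp add: weak_Lim_eq)
    qed
    ultimately show ?thesis using p by blast
  qed
  then obtain p where p: "\<And>\<epsilon>. \<epsilon> \<in> {0<..<\<eta>} \<Longrightarrow> p \<epsilon> \<in> Fix (cyclic_comp T \<epsilon> m)"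
    and p_bound: "\<And>\<epsilon>. \<epsilon> \<in> {0<..<\<eta>} \<Longrightarrow> norm (p \<epsilon>) \<le> M"
    and p_orth: "\<And>\<epsilon> e. \<epsilon> \<in> {0<..<\<eta>} \<Longrightarrow> e \<in> E \<Longrightarrow> p \<epsilon> \<bullet> e = y0 \<bullet> e"
    and x_p: "\<And>\<epsilon> i. \<epsilon> \<in> {0<..<\<eta>} \<Longrightarrow> i \<in> ?I \<Longrightarrow> x \<epsilon> i = cyclic_comp T \<epsilon> i (p \<epsilon>)"
    by metis

  have res: "((\<lambda>\<epsilon>. p \<epsilon> - Tbar (p \<epsilon>)) \<longlongrightarrow> 0) ?F"
  proof -
    obtain K where K: "\<And>\<epsilon> v. \<epsilon> \<in> {0..1} \<Longrightarrow> norm v \<le> M \<Longrightarrow>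
        norm (cyclic_comp T \<epsilon> m v - v - \<epsilon> *\<^sub>R (\<Sum>i\<in>?I. T i v - v)) \<le> K * \<epsilon>\<^sup>2"
      using cyclic_comp_first_order[of m T M, OF nonexp] by blast
    have "norm (p \<epsilon> - Tbar (p \<epsilon>)) \<le> K * \<epsilon>" if \<epsilon>: "\<epsilon> \<in> {0<..<\<eta>}" for \<epsilon>
    proof -
      let ?s = "\<Sum>i\<in>?I. T i (p \<epsilon>) - p \<epsilon>"
      have "\<epsilon> * norm ?s \<le> \<epsilon> * (K * \<epsilon>)"
        using K[OF \<epsilon>01(4)[OF \<epsilon>] p_bound[OF \<epsilon>]] p[OF \<epsilon>] \<epsilon>
        by (simp add: Fix_def power2_eq_square algebra_simps)
      then have "norm ?s \<le> K * \<epsilon>" using \<epsilon> by simp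
      moreover have "norm (p \<epsilon> - Tbar (p \<epsilon>)) = norm ?s / real m"
        unfolding norm_minus_commute[of "p \<epsilon>" "Tbar (p \<epsilon>)"] residual by simp
      moreover have "norm ?s / real m \<le> norm ?s / 1"
        using m by (intro divide_left_mono) auto
      ultimately show ?thesis by simp
    qed
    then show ?thesis by (rule null)
  qed

  have shift: "((\<lambda>\<epsilon>. x \<epsilon> i - p \<epsilon>) \<longlongrightarrow> 0) ?F" if i: "i \<in> ?I" for i
  proof -
    obtain K where K: "\<And>\<epsilon> v. \<epsilon> \<in> {0..1} \<Longrightarrow> norm v \<le> M \<Longrightarrow> norm (cyclic_comp T \<epsilon> i v - v) \<le> K * \<epsilon>"
      using cyclic_comp_displacement[of i T M] nonexp i by force
    have "norm (x \<epsilon> i - p \<epsilon>) \<le> K * \<epsilon>" if "\<epsilon> \<in> {0<..<\<eta>}" for \<epsilon>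
      using K[OF \<epsilon>01(4) p_bound] x_p i that by simp
    then show ?thesis by (rule null)
  qed

  have p_weak: "weakly_tendsto p xbar ?F"
  proof (rule weakly_tendstoI_refinements[of _ M])
    show bound: "eventually (\<lambda>\<epsilon>. norm (p \<epsilon>) \<le> M) ?F" using p_bound by (rule ev)
    fix F' l
    assume F': "F' \<le> ?F" "F' \<noteq> bot" "weakly_tendsto p l F'"
    have "Tbar l = l"
      using Tbar_nonexp F'(2,3) filter_leD[OF F'(1) bound] tendsto_mono[OF F'(1) res]
      by (rule nonexpansive_demiclosed)
    then have "l \<in> S" by (simp add: S_fix)
    have "l \<bullet> e = xbar \<bullet> e" if "e \<in> E" for e
    proof -
      have "eventually (\<lambda>\<epsilon>. xbar \<bullet> e = p \<epsilon> \<bullet> e) ?F"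
        using p_orth that xbar_orth by (intro ev) auto
      then have "eventually (\<lambda>\<epsilon>. xbar \<bullet> e = p \<epsilon> \<bullet> e) F'" by (rule filter_leD[OF F'(1)])
      then have "((\<lambda>\<epsilon>. p \<epsilon> \<bullet> e) \<longlongrightarrow> xbar \<bullet> e) F'" by (rule Lim_transform_eventually[rotated]) simp
      moreover have "((\<lambda>\<epsilon>. p \<epsilon> \<bullet> e) \<longlongrightarrow> l \<bullet> e) F'" using F'(3) by (simp add: weakly_tendsto_def)
      ultimately show ?thesis using tendsto_unique[OF F'(2)] by blast
    qed
    (* l and xbar both lie in z + E and have the same component along E *)
    from this[OF S_diff[OF \<open>l \<in> S\<close> xbar_S]] have "(l - xbar) \<bullet> (l - xbar) = 0"
      by (simp add: inner_diff_left)
    then show "l = xbar" by simp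
  qed

  have weak: "weakly_tendsto (\<lambda>\<epsilon>. x \<epsilon> i) xbar ?F" if "i \<in> ?I" for i
    using weakly_tendsto_strong_perturbation[OF p_weak shift[OF that]] by simp

  have strong: "((\<lambda>\<epsilon>. x \<epsilon> i) \<longlongrightarrow> xbar) ?F"
    if contr: "\<forall>s\<in>S. \<exists>\<rho>\<in>{0..<1}. \<exists>\<delta>>0. \<forall>v \<in> cball 0 \<delta> \<inter> E\<^sup>\<bottom>.
        norm (Tbar (v + s) - Tbar s) \<le> \<rho> * norm v" and i: "i \<in> ?I" for i
  proof -
    have fix_xbar: "Tbar xbar = xbar" using xbar_S by (simp add: S_fix)
    obtain \<rho> \<delta> where \<rho>: "\<rho> < 1" and \<delta>: "\<delta> > 0"
      and c: "\<And>v. v \<in> E\<^sup>\<bottom> \<Longrightarrow> norm v \<le> \<delta> \<Longrightarrow> norm (Tbar (v + xbar) - xbar) \<le> \<rho> * norm v"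
      using contr[rule_format, OF xbar_S] fix_xbar by auto
    have key: "(1 - \<rho>) * min (norm (p \<epsilon> - xbar)) \<delta> \<le> norm (p \<epsilon> - Tbar (p \<epsilon>))"
      if \<epsilon>: "\<epsilon> \<in> {0<..<\<eta>}" for \<epsilon>
    proof -
      have "p \<epsilon> - xbar \<in> E\<^sup>\<bottom>"
        using p_orth[OF \<epsilon>] xbar_orth
        by (auto simp: orthogonal_comp_def orthogonal_def inner_diff_right inner_commute)
      from residual_lower_bound_of_local_contraction[OF Tbar_nonexp fix_xbar
          subspace_orthogonal_comp this \<delta> c]
      show ?thesis by simp
    qed
    have "(p \<longlongrightarrow> xbar) ?F"
    proof (rule tendstoI)
      fix e :: real assume "e > 0"
      then have "0 < (1 - \<rho>) * min e \<delta>" using \<rho> \<delta> by simp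
      then have "eventually (\<lambda>\<epsilon>. norm (p \<epsilon> - Tbar (p \<epsilon>)) < (1 - \<rho>) * min e \<delta>) ?F"
        using order_tendstoD(2)[OF tendsto_norm_zero[OF res]] by blast
      moreover have "eventually (\<lambda>\<epsilon>. \<epsilon> \<in> {0<..<\<eta>}) ?F" by (rule ev)
      ultimately show "eventually (\<lambda>\<epsilon>. dist (p \<epsilon>) xbar < e) ?F"
      proof eventually_elim
        case (elim \<epsilon>)
        have "(1 - \<rho>) * min (norm (p \<epsilon> - xbar)) \<delta> < (1 - \<rho>) * min e \<delta>"
          using key[OF elim(2)] elim(1) by linarith
        then show ?case using \<rho> by (simp add: dist_norm min_def split: if_splits)
      qed
    qed
    from tendsto_add[OF shift[OF i] this] show ?thesis by simp
  qed
  show ?thesis using weak strong by blast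
qed

end
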